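(* Let $M\in\mathbb H_\infty$ be a positively dominated system with $m$ inputs and $m$ outputs and transfer matrix $\hat M(j\omega)\in\mathbb C^{m\times m}$, $\omega\in\mathbb R$. Let $\boldsymbol\Delta_{\mathbb{RC}}$, $\boldsymbol\Delta$ and $\boldsymbol\Theta$ be the sets of $m\times m$ matrices defined in the context. Then $$\sup_{\omega\in\mathbb R}\mu(\hat M(j\omega),\boldsymbol\Delta_{\mathbb{RC}})=\sup_{\omega\in\mathbb R}\mu(\hat M(j\omega),\boldsymbol\Delta)=\inf_{\Theta\in\boldsymbol\Theta}\left\|\Theta^{\frac12}\hat M(0)\Theta^{-\frac12}\right\|.$$
   Context: Systems. $\mathbb H_\infty$ denotes the space of causal linear time-invariant operators mapping $L_2^m$ (square-integrable signals) to itself; $\hat M(j\omega)$ is the transfer function of $M$ in the Laplace domain evaluated on the imaginary axis, with entries $\hat m_{ik}(j\omega)$. The system $M\in\mathbb H_\infty$ is positively dominated if $\sup_{\omega\in\mathbb R}|\hat m_{ik}(j\omega)|=\hat m_{ik}(0)$ for all $i,k\in\{1,\dots,m\}$. Uncertainty structures. Fix integers $f,s\ge 0$, block sizes $m_1,\dots,m_{f+s}\ge1$ with $\sum_i m_i=m$, and a partition $\{1,\dots,f+s\}=\mathcal I_{\mathbb R}\cup\mathcal I_{\mathbb C}$ into disjoint sets. Let $\boldsymbol\Delta_{\mathbb{RC}}$ be the set of block diagonal matrices $\mathrm{diag}(\Delta_1,\dots,\Delta_f,\delta_{f+1}I_{m_{f+1}},\dots,\delta_{f+s}I_{m_{f+s}})$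 where, for $i\le f$, $\Delta_i\in\mathbb R^{m_i\times m_i}$ if $i\in\mathcal I_{\mathbb R}$ and $\Delta_i\in\mathbb C^{m_i\times m_i}$ if $i\in\mathcal I_{\mathbb C}$; and for $f<i\le f+s$, $\delta_i\in\mathbb R$ if $i\in\mathcal I_{\mathbb R}$ and $\delta_i\in\mathbb C$ if $i\in\mathcal I_{\mathbb C}$. Let $\bar s:=\sum_{k=f+1}^{f+s}m_k$. Define $$\boldsymbol\Delta=\{\mathrm{diag}(\Delta_1,\dots,\Delta_f,\delta_{f+1},\dots,\delta_{f+\bar s}):\ \Delta_k\in\mathbb R_+^{m_k\times m_k}\ (1\le k\le f),\ \delta_k\in\mathbb R_+\ (f+1\le k\le f+\bar s)\},$$ $$\boldsymbol\Theta=\{\mathrm{diag}(\theta_1I_{m_1},\dots,\theta_fI_{m_f},\theta_{f+1},\dots,\theta_{f+\bar s}):\ \theta_k>0\ (1\le k\le f+\bar s)\},$$ where $\mathbb R_+=[0,\infty)$. Structured singular value. $\|\cdot\|$ is the spectral norm (largest singular value). For $A\in\mathbb C^{m\times m}$ and a set $\mathbf D\subset\mathbb C^{m\times m}$, $$\mu(A,\mathbf D):=\frac1{\inf\{\|\Delta\|:\Delta\in\mathbf D,\ \det(I-A\Delta)=0\}},$$ with $\mu(A,\mathbf D)=0$ if no $\Delta\in\mathbf D$ satisfies $\det(I-A\Delta)=0$. *)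

theory Defs
  imports "HOL-Analysis.Analysis"
begin

section \<open>Systems\<close>

text \<open>Signals live on the time axis \<open>[0, \<infinity>)\<close>; they are represented by functions on the reals whose
  values at negative times are ignored, and equality of signals is equality almost everywhere
  on \<open>[0, \<infinity>)\<close>.\<close>

definition L2_signals :: "(real \<Rightarrow> complex ^ 'm) set" where
  "L2_signals = {u. set_borel_measurable lborel {0..} u \<and>
                    set_integrable lborel {0..} (\<lambda>t. (norm (u t))\<^sup>2)}"

definition L2_norm :: "(real \<Rightarrow> complex ^ 'm) \<Rightarrow> real" where
  "L2_norm u = sqrt (LINT t:{0..}|lborel. (norm (u t))\<^sup>2)"

definition delay :: "real \<Rightarrow> (real \<Rightarrow> complex ^ 'm) \<Rightarrow> real \<Rightarrow> complex ^ 'm" where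
  "delay \<tau> u t = (if t < \<tau> then 0 else u (t - \<tau>))"

definition H_inf :: "((real \<Rightarrow> complex ^ 'm) \<Rightarrow> (real \<Rightarrow> complex ^ 'm)) set" where
  "H_inf = {M.
     (\<forall>u\<in>L2_signals. M u \<in> L2_signals) \<and>
     (\<forall>u\<in>L2_signals. \<forall>v\<in>L2_signals.
        AE t in lborel. t \<ge> 0 \<longrightarrow> M (\<lambda>x. u x + v x) t = M u t + M v t) \<and>
     (\<forall>c. \<forall>u\<in>L2_signals. AE t in lborel. t \<ge> 0 \<longrightarrow> M (\<lambda>x. c *s u x) t = c *s M u t) \<and>
     (\<exists>C. \<forall>u\<in>L2_signals. L2_norm (M u) \<le> C * L2_norm u) \<and>
     (\<forall>T\<ge>0. \<forall>u\<in>L2_signals. \<forall>v\<in>L2_signals.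
        (AE t in lborel. 0 \<le> t \<and> t \<le> T \<longrightarrow> u t = v t) \<longrightarrow>
        (AE t in lborel. 0 \<le> t \<and> t \<le> T \<longrightarrow> M u t = M v t)) \<and>
     (\<forall>\<tau>\<ge>0. \<forall>u\<in>L2_signals. AE t in lborel. t \<ge> 0 \<longrightarrow> M (delay \<tau> u) t = delay \<tau> (M u) t)}"

definition laplace :: "(real \<Rightarrow> complex ^ 'm) \<Rightarrow> complex \<Rightarrow> complex ^ 'm" where
  "laplace u s = (LINT t:{0..}|lborel. exp (- (s * of_real t)) *s u t)"

text \<open>The first conjunct determines \<open>G\<close> on the open right half plane, where it is bounded and
  analytic. On the imaginary axis \<open>G\<close> is the boundary value, entry by entry. For a general system
  boundary values exist only almost everywhere; on the exceptional null set the values of \<open>G\<close>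
  are left unconstrained.\<close>

definition has_transfer_function ::
  "((real \<Rightarrow> complex ^ 'm) \<Rightarrow> (real \<Rightarrow> complex ^ 'm)) \<Rightarrow> (complex \<Rightarrow> complex ^ 'm ^ 'm) \<Rightarrow> bool" where
  "has_transfer_function M G \<longleftrightarrow>
     (\<forall>s. Re s > 0 \<longrightarrow> (\<forall>u\<in>L2_signals. laplace (M u) s = G s *v laplace u s)) \<and>
     (\<forall>\<omega> i k l. ((\<lambda>\<sigma>. G (of_real \<sigma> + \<i> * of_real \<omega>) $ i $ k) \<longlongrightarrow> l) (at_right (0::real)) \<longrightarrow>
        G (\<i> * of_real \<omega>) $ i $ k = l)"

definition positively_dominated :: "(complex \<Rightarrow> complex ^ 'm ^ 'm) \<Rightarrow> bool" where
  "positively_dominated G \<longleftrightarrow>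
     (\<forall>i k. G 0 $ i $ k \<in> \<real> \<and>
        (SUP \<omega>::real. ereal (cmod (G (\<i> * of_real \<omega>) $ i $ k))) = ereal (Re (G 0 $ i $ k)))"

section \<open>Structured singular value\<close>

definition conj_transpose :: "complex ^ 'm ^ 'n \<Rightarrow> complex ^ 'n ^ 'm" where
  "conj_transpose A = (\<chi> i j. cnj (A $ j $ i))"

definition singular_values :: "complex ^ 'm ^ 'n \<Rightarrow> real set" where
  "singular_values A =
     {sqrt l | l. \<exists>v. v \<noteq> 0 \<and> (conj_transpose A ** A) *v v = of_real l *s v}"

definition spectral_norm :: "complex ^ 'm ^ 'n \<Rightarrow> real" where
  "spectral_norm A = Max (singular_values A)"

definition mu :: "complex ^ 'm ^ 'm \<Rightarrow> (complex ^ 'm ^ 'm) set \<Rightarrow> real" where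
  "mu A D =
     (if \<exists>\<Delta>\<in>D. det (mat 1 - A ** \<Delta>) = 0
      then 1 / Inf {spectral_norm \<Delta> | \<Delta>. \<Delta> \<in> D \<and> det (mat 1 - A ** \<Delta>) = 0}
      else 0)"

section \<open>Uncertainty structures\<close>

text \<open>The linearly ordered index type \<open>'m\<close> plays the role of \<open>{1, \<dots>, m}\<close>: the index \<open>j\<close> is
  coordinate number \<open>card {..j}\<close>. The blocks are consecutive, block \<open>i\<close> having size \<open>msz i\<close>.\<close>

definition block :: "(nat \<Rightarrow> nat) \<Rightarrow> 'm::{finite,linorder} \<Rightarrow> nat" where
  "block msz j = (LEAST i. card {..j} \<le> (\<Sum>l=1..i. msz l))"

text \<open>Blocks after the repeated scalar blocks have been split into \<open>1 \<times> 1\<close> blocks, numbered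
  from \<open>1\<close> to \<open>f + sbar f s msz\<close>.\<close>

definition split_block :: "nat \<Rightarrow> (nat \<Rightarrow> nat) \<Rightarrow> 'm::{finite,linorder} \<Rightarrow> nat" where
  "split_block f msz j =
     (if block msz j \<le> f then block msz j else f + (card {..j} - (\<Sum>l=1..f. msz l)))"

definition sbar :: "nat \<Rightarrow> nat \<Rightarrow> (nat \<Rightarrow> nat) \<Rightarrow> nat" where
  "sbar f s msz = (\<Sum>k=f+1..f+s. msz k)"

text \<open>In the next two definitions the full blocks are indexed by the coordinates of the whole
  matrix; only the entries of \<open>B i\<close> with both coordinates in block \<open>i\<close> are used. Blocks outside
  \<open>IR\<close> are unrestricted complex blocks.\<close>

definition Delta_RC ::
  "nat \<Rightarrow> nat \<Rightarrow> (nat \<Rightarrow> nat) \<Rightarrow> nat set \<Rightarrow> (complex ^ 'm::{finite,linorder} ^ 'm::{finite,linorder}) set" where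
  "Delta_RC f s msz IR =
     {\<chi> j k. if block msz j \<noteq> block msz k then 0
             else if block msz j \<le> f then B (block msz j) $ j $ k
             else if j = k then \<delta> (block msz j) else 0
      | (B :: nat \<Rightarrow> complex ^ 'm::{finite,linorder} ^ 'm::{finite,linorder}) (\<delta> :: nat \<Rightarrow> complex).
        (\<forall>i\<in>{1..f} \<inter> IR. \<forall>j k. B i $ j $ k \<in> \<real>) \<and>
        (\<forall>i\<in>{f+1..f+s} \<inter> IR. \<delta> i \<in> \<real>)}"

definition Delta_plus ::
  "nat \<Rightarrow> nat \<Rightarrow> (nat \<Rightarrow> nat) \<Rightarrow> (complex ^ 'm::{finite,linorder} ^ 'm::{finite,linorder}) set" where
  "Delta_plus f s msz =
     {\<chi> j k. if split_block f msz j \<noteq> split_block f msz k then 0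
             else if split_block f msz j \<le> f then of_real (B (split_block f msz j) $ j $ k)
             else of_real (\<delta> (split_block f msz j))
      | (B :: nat \<Rightarrow> real ^ 'm::{finite,linorder} ^ 'm::{finite,linorder}) (\<delta> :: nat \<Rightarrow> real).
        (\<forall>k\<in>{1..f}. \<forall>i j. B k $ i $ j \<ge> 0) \<and> (\<forall>k\<in>{f+1..f+sbar f s msz}. \<delta> k \<ge> 0)}"

definition Theta ::
  "nat \<Rightarrow> nat \<Rightarrow> (nat \<Rightarrow> nat) \<Rightarrow> (complex ^ 'm::{finite,linorder} ^ 'm::{finite,linorder}) set" where
  "Theta f s msz =
     {\<chi> j k. if j = k then of_real (\<theta> (split_block f msz j)) else 0
      | \<theta> :: nat \<Rightarrow> real. \<forall>k\<in>{1..f+sbar f s msz}. \<theta> k > 0}"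

text \<open>Real powers of a diagonal matrix with positive real diagonal.\<close>

definition diag_powr :: "complex ^ 'm ^ 'm \<Rightarrow> real \<Rightarrow> complex ^ 'm ^ 'm" where
  "diag_powr A a = (\<chi> j k. if j = k then of_real (Re (A $ j $ j) powr a) else 0)"

end

theory Submission
  imports Defs
begin

text \<open>
Upper bound: every perturbation in either set commutes with the scalings in
\<open>\<Theta>\<close>, so a singular \<open>I - A \<Delta>\<close> forces \<open>1 \<le> \<parallel>\<Theta>^(1/2) A \<Theta>^(-1/2)\<parallel> \<parallel>\<Delta>\<parallel>\<close>, and the scaled norm is monotone
under entrywise domination by \<open>P = M(0) \<ge> 0\<close>.

Lower bound, at frequency \<open>0\<close>: in the variables \<open>u = x\<^sup>2\<close> (entrywise, \<open>x \<ge> 0\<close>) the block functions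
\<open>\<parallel>(P x)\<^sub>i\<parallel>\<^sup>2 - c\<^sup>2 \<parallel>x\<^sub>i\<parallel>\<^sup>2\<close> are concave. Separating their values on the simplex from the nonnegative
orthant yields either a scaling whose norm is at most \<open>c\<close>, or a nonzero \<open>x \<ge> 0\<close> making all of them
nonnegative. In the latter case blockwise rank one matrices of norm at most \<open>1/c\<close> on the full
blocks, and \<open>1/c\<close> on the scalar ones, define \<open>D \<ge> 0\<close> with \<open>D P x \<ge> x\<close>. By Perron-Frobenius \<open>D P\<close>
has an eigenvalue \<open>l \<ge> 1\<close>, and \<open>D / l\<close> is a singular perturbation lying in both sets.
\<close>

section \<open>Spectral norm and structured singular value\<close>

lemma matrix_vector_mult_scaleR_complex:
  fixes A :: "complex ^ 'n ^ 'm"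
  shows "A *v (r *\<^sub>R x) = r *\<^sub>R (A *v x)"
  by (simp add: matrix_vector_mult_def vec_eq_iff scaleR_sum_right)

text \<open>The inner product on \<open>complex ^ 'n\<close> is the real part of the Hermitian form;
  \<open>conj_transpose\<close> is still the adjoint for it, so real Euclidean arguments
  apply.\<close>

lemma inner_matrix_vector_mult_complex:
  fixes A :: "complex ^ 'n ^ 'm"
  shows "(A *v v) \<bullet> w = v \<bullet> (conj_transpose A *v w)"
proof -
  have *: "(a * b) \<bullet> c = b \<bullet> (cnj a * c)" for a b c :: complex
    by (simp add: inner_complex_def algebra_simps)
  have "(A *v v) \<bullet> w = (\<Sum>i\<in>UNIV. \<Sum>j\<in>UNIV. v $ j \<bullet> (cnj (A $ i $ j) * w $ i))"
    by (simp add: inner_vec_def matrix_vector_mult_def inner_sum_left *)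
  also have "\<dots> = (\<Sum>j\<in>UNIV. \<Sum>i\<in>UNIV. v $ j \<bullet> (cnj (A $ i $ j) * w $ i))"
    by (rule sum.swap)
  also have "\<dots> = v \<bullet> (conj_transpose A *v w)"
    by (simp add: inner_vec_def matrix_vector_mult_def conj_transpose_def inner_sum_right)
  finally show ?thesis .
qed

lemma of_real_vector_smult: "of_real l *s v = l *\<^sub>R (v :: complex ^ 'n)"
  by (simp add: vector_scalar_mult_def vec_eq_iff scaleR_conv_of_real[where 'a = complex])

lemma norm_matrix_vector_eigen:
  fixes A :: "complex ^ 'n ^ 'm"
  assumes "(conj_transpose A ** A) *v v = of_real l *s v"
  shows "(norm (A *v v))\<^sup>2 = l * (norm v)\<^sup>2"
proof -
  have "(norm (A *v v))\<^sup>2 = v \<bullet> (conj_transpose A *v (A *v v))"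
    by (metis inner_matrix_vector_mult_complex power2_norm_eq_inner)
  also have "\<dots> = l * (v \<bullet> v)"
    using assms by (simp add: matrix_vector_mul_assoc of_real_vector_smult)
  finally show ?thesis by (simp add: power2_norm_eq_inner)
qed

text \<open>Let \<open>v\<close> maximise \<open>norm (A *v w)\<close> over the unit sphere. The
  form \<open>l * (norm w)^2 - (norm (A *v w))^2\<close> is nonnegative and vanishes at
  \<open>v\<close>, so its gradient vanishes there, which is the eigenvector equation.\<close>

lemma max_singular_vector:
  fixes A :: "complex ^ 'n ^ 'm"
  shows "\<exists>l v. v \<noteq> 0 \<and> (conj_transpose A ** A) *v v = of_real l *s v \<and>
    (\<forall>w. (norm (A *v w))\<^sup>2 \<le> l * (norm w)\<^sup>2)"
proof -
  have cont: "continuous_on (sphere 0 1) (\<lambda>w. norm (A *v w))"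
    by (auto intro!: continuous_intros continuous_on_vec_lambda
        simp: matrix_vector_mult_def)
  have "sphere (0 :: complex ^ 'n) 1 \<noteq> {}" by simp
  then obtain v where v: "norm v = 1" and
    mx: "\<And>w. norm w = 1 \<Longrightarrow> norm (A *v w) \<le> norm (A *v v)"
    using continuous_attains_sup[OF compact_sphere _ cont] by auto
  define l where "l = (norm (A *v v))\<^sup>2"
  have le: "(norm (A *v w))\<^sup>2 \<le> l * (norm w)\<^sup>2" for w
  proof (cases "w = 0")
    case True
    then show ?thesis by simp
  next
    case False
    have "norm (A *v w) = norm w * norm (A *v (inverse (norm w) *\<^sub>R w))"
      using False by (simp add: matrix_vector_mult_scaleR_complex)
    also have "\<dots> \<le> norm w * norm (A *v v)"
      using mx[of "inverse (norm w) *\<^sub>R w"] False by (intro mult_left_mono) auto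
    finally have "(norm (A *v w))\<^sup>2 \<le> (norm w * norm (A *v v))\<^sup>2"
      by (rule power_mono) simp
    then show ?thesis by (simp add: l_def power_mult_distrib mult.commute)
  qed
  \<comment> \<open>\<open>u\<close> is half the gradient of the form at \<open>v\<close>, and
    \<open>q\<close> is the value of the form at \<open>u\<close>.\<close>
  define u where "u = l *\<^sub>R v - (conj_transpose A ** A) *v v"
  define q where "q = l * (norm u)\<^sup>2 - (norm (A *v u))\<^sup>2"
  have q: "q \<ge> 0" using le[of u] by (simp add: q_def)
  have uu: "l * (v \<bullet> u) - (A *v v) \<bullet> (A *v u) = u \<bullet> u"
  proof -
    have "(A *v v) \<bullet> (A *v u) = ((conj_transpose A ** A) *v v) \<bullet> u"
      by (metis inner_commute inner_matrix_vector_mult_complex matrix_vector_mul_assoc)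
    moreover have "u \<bullet> w = l * (v \<bullet> w) - ((conj_transpose A ** A) *v v) \<bullet> w" for w
      by (simp add: u_def inner_diff_left)
    ultimately show ?thesis by simp
  qed
  have sq: "(norm (a + t *\<^sub>R b))\<^sup>2 = (norm a)\<^sup>2 + 2 * t * (a \<bullet> b) + t\<^sup>2 * (norm b)\<^sup>2"
    for a b :: "complex ^ 'x" and t
    unfolding power2_norm_eq_inner
    by (simp add: inner_add_left inner_add_right inner_commute[of b a] power2_eq_square algebra_simps)
  \<comment> \<open>The form along the line through \<open>v\<close> in direction \<open>u\<close>;
    the constant term is its value at \<open>v\<close>, which is zero.\<close>
  have pos: "0 \<le> 2 * t * (u \<bullet> u) + t\<^sup>2 * q" for t
  proof -
    have "(norm (A *v (v + t *\<^sub>R u)))\<^sup>2 \<le> l * (norm (v + t *\<^sub>R u))\<^sup>2" by (rule le)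
    also have "(norm (A *v (v + t *\<^sub>R u)))\<^sup>2
        = l + 2 * t * ((A *v v) \<bullet> (A *v u)) + t\<^sup>2 * (norm (A *v u))\<^sup>2"
      by (simp add: matrix_vector_right_distrib matrix_vector_mult_scaleR_complex sq l_def)
    also have "(norm (v + t *\<^sub>R u))\<^sup>2 = 1 + 2 * t * (v \<bullet> u) + t\<^sup>2 * (norm u)\<^sup>2"
      using v by (simp add: sq)
    finally have "0 \<le> 2 * t * (l * (v \<bullet> u) - (A *v v) \<bullet> (A *v u)) + t\<^sup>2 * q"
      by (simp add: q_def algebra_simps)
    then show ?thesis by (simp only: uu)
  qed
  have "u \<bullet> u = 0"
  proof (rule ccontr)
    assume "u \<bullet> u \<noteq> 0"
    then have p: "u \<bullet> u > 0" by simp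
    \<comment> \<open>With this negative \<open>t\<close> the linear term wins; the
      \<open>+ 1\<close> keeps the denominator positive when \<open>q = 0\<close>.\<close>
    define t where "t = - (u \<bullet> u) / (q + 1)"
    have "2 * t * (u \<bullet> u) + t\<^sup>2 * q = - ((u \<bullet> u)\<^sup>2 * (q + 2) / (q + 1)\<^sup>2)"
      using q unfolding t_def by (simp add: divide_simps power2_eq_square) algebra
    also have "\<dots> < 0" using q p by simp
    finally show False using pos[of t] by simp
  qed
  then have "(conj_transpose A ** A) *v v = of_real l *s v"
    by (simp add: u_def of_real_vector_smult)
  moreover have "v \<noteq> 0" using v by auto
  ultimately show ?thesis using le by blast
qed

text \<open>Finiteness makes the \<open>Max\<close> in \<open>spectral_norm\<close> meaningful.
  Eigenvectors for distinct eigenvalues are orthogonal, hence independent, and the dimension bounds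
  their number.\<close>

lemma finite_singular_values:
  fixes A :: "complex ^ 'n ^ 'm"
  shows "finite (singular_values A)"
proof -
  define L where "L = {l. \<exists>v. v \<noteq> 0 \<and> (conj_transpose A ** A) *v v = of_real l *s v}"
  define e where "e l = (SOME v. v \<noteq> 0 \<and> (conj_transpose A ** A) *v v = of_real l *s v)" for l
  have e: "e l \<noteq> 0" "(conj_transpose A ** A) *v e l = of_real l *s e l" if "l \<in> L" for l
    using that someI_ex[of "\<lambda>v. v \<noteq> 0 \<and> (conj_transpose A ** A) *v v = of_real l *s v"]
    by (auto simp: L_def e_def)
  have orth: "e l \<bullet> e k = 0" if "l \<in> L" "k \<in> L" "l \<noteq> k" for l k
  proof -
    have "(A *v e l) \<bullet> (A *v e k) = k * (e l \<bullet> e k)"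
      using e(2)[OF that(2)]
      by (simp add: inner_matrix_vector_mult_complex matrix_vector_mul_assoc of_real_vector_smult)
    moreover have "(A *v e k) \<bullet> (A *v e l) = l * (e l \<bullet> e k)"
      using e(2)[OF that(1)]
      by (simp add: inner_matrix_vector_mult_complex matrix_vector_mul_assoc of_real_vector_smult
          inner_commute)
    ultimately show ?thesis using that(3) by (simp add: inner_commute)
  qed
  have inj: "inj_on e L"
    by (rule inj_onI) (metis e(1) inner_eq_zero_iff orth)
  have "pairwise orthogonal (e ` L)"
    using orth by (auto simp: pairwise_def orthogonal_def)
  moreover have "0 \<notin> e ` L" using e(1) by force
  ultimately have "finite (e ` L)"
    by (intro finiteI_independent pairwise_orthogonal_independent)
  then have "finite L" using inj finite_imageD by blast
  moreover have "singular_values A = sqrt ` L"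
    by (auto simp: singular_values_def L_def)
  ultimately show ?thesis by simp
qed

lemma norm_matrix_vector_le_spectral_norm:
  fixes A :: "complex ^ 'n ^ 'm"
  shows "norm (A *v w) \<le> spectral_norm A * norm w"
proof -
  obtain l v where v: "v \<noteq> 0" "(conj_transpose A ** A) *v v = of_real l *s v"
    and le: "\<And>w. (norm (A *v w))\<^sup>2 \<le> l * (norm w)\<^sup>2"
    using max_singular_vector[of A] by blast
  have "norm (A *v w) \<le> sqrt (l * (norm w)\<^sup>2)"
    using le[of w] by (rule real_le_rsqrt)
  also have "\<dots> = sqrt l * norm w" by (simp add: real_sqrt_mult)
  also have "sqrt l \<le> spectral_norm A"
    unfolding spectral_norm_def using v
    by (intro Max_ge finite_singular_values) (auto simp: singular_values_def)
  finally show ?thesis by (simp add: mult_right_mono)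
qed

text \<open>The maximum is some singular value \<open>sqrt l\<close>, and testing the bound on its
  eigenvector gives \<open>l \<le> c^2\<close>.\<close>

lemma spectral_norm_le:
  fixes A :: "complex ^ 'n ^ 'm"
  assumes "c \<ge> 0" and "\<And>v. norm (A *v v) \<le> c * norm v"
  shows "spectral_norm A \<le> c"
proof -
  have "singular_values A \<noteq> {}"
    using max_singular_vector[of A] by (auto simp: singular_values_def)
  then have "spectral_norm A \<in> singular_values A"
    unfolding spectral_norm_def by (intro Max_in finite_singular_values)
  then obtain l v where v: "v \<noteq> 0" "(conj_transpose A ** A) *v v = of_real l *s v"
    and l: "spectral_norm A = sqrt l"
    by (auto simp: singular_values_def)
  have "l * (norm v)\<^sup>2 \<le> c\<^sup>2 * (norm v)\<^sup>2"
    using power_mono[OF assms(2)[of v] norm_ge_zero, of 2] norm_matrix_vector_eigen[OF v(2)]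
    by (simp add: power_mult_distrib)
  then have "l \<le> c\<^sup>2" using v(1) by simp
  then show ?thesis using assms(1) l by (simp add: real_le_lsqrt)
qed

lemma spectral_norm_nonneg: "spectral_norm (A :: complex ^ 'n ^ 'm) \<ge> 0"
proof -
  have "0 \<le> norm (A *v axis undefined 1)" by simp
  also have "\<dots> \<le> spectral_norm A * norm (axis undefined 1 :: complex ^ 'n)"
    by (rule norm_matrix_vector_le_spectral_norm)
  finally show ?thesis by simp
qed

lemma norm_matrix_vector_dominated:
  fixes A :: "complex ^ 'n ^ 'm" and P :: "real ^ 'n ^ 'm"
  assumes "\<And>i j. cmod (A $ i $ j) \<le> P $ i $ j"
  shows "norm (A *v v) \<le> norm (P *v (\<chi> i. cmod (v $ i)))"
  unfolding norm_vec_def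
proof (rule L2_set_mono)
  fix i
  have "cmod ((A *v v) $ i) \<le> (\<Sum>j\<in>UNIV. cmod (A $ i $ j) * cmod (v $ j))"
    unfolding matrix_vector_mult_def
    by (simp add: norm_mult sum_norm_le)
  also have "\<dots> \<le> (\<Sum>j\<in>UNIV. P $ i $ j * cmod (v $ j))"
    by (intro sum_mono mult_right_mono assms) simp
  also have "\<dots> \<le> norm ((P *v (\<chi> i. cmod (v $ i))) $ i)"
    by (simp add: matrix_vector_mult_def)
  finally show "cmod ((A *v v) $ i) \<le> norm ((P *v (\<chi> i. cmod (v $ i))) $ i)" .
qed simp

section \<open>Singular perturbations and bounds on \<open>mu\<close>\<close>

lemma det_zero_kernel:
  fixes A :: "'a::field ^ 'n ^ 'n"
  shows "det (mat 1 - A) = 0 \<longleftrightarrow> (\<exists>v. v \<noteq> 0 \<and> A *v v = v)"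
proof -
  have "det (mat 1 - A) = 0 \<longleftrightarrow> \<not> (\<exists>B. B ** (mat 1 - A) = mat 1)"
    using invertible_det_nz[of "mat 1 - A"] invertible_left_inverse[of "mat 1 - A"] by blast
  also have "\<dots> \<longleftrightarrow> (\<exists>v. (mat 1 - A) *v v = 0 \<and> v \<noteq> 0)"
    by (auto simp: matrix_left_invertible_ker)
  also have "\<dots> \<longleftrightarrow> (\<exists>v. v \<noteq> 0 \<and> A *v v = v)"
  proof -
    have "(mat 1 - A) *v v = 0 \<longleftrightarrow> A *v v = v" for v
      by (auto simp: matrix_vector_mult_diff_rdistrib)
    then show ?thesis by blast
  qed
  finally show ?thesis .
qed

lemma spectral_norm_mult_ge_1:
  fixes A \<Delta> :: "complex ^ 'n ^ 'n"
  assumes "det (mat 1 - A ** \<Delta>) = 0"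
  shows "1 \<le> spectral_norm A * spectral_norm \<Delta>"
proof -
  obtain v where v: "v \<noteq> 0" "(A ** \<Delta>) *v v = v"
    using assms by (auto simp: det_zero_kernel)
  have "norm v = norm (A *v (\<Delta> *v v))" using v(2) by (simp add: matrix_vector_mul_assoc)
  also have "\<dots> \<le> spectral_norm A * norm (\<Delta> *v v)"
    by (rule norm_matrix_vector_le_spectral_norm)
  also have "\<dots> \<le> spectral_norm A * (spectral_norm \<Delta> * norm v)"
    by (intro mult_left_mono norm_matrix_vector_le_spectral_norm spectral_norm_nonneg)
  finally show ?thesis using v(1) by simp
qed

lemma mu_nonneg: "mu A D \<ge> 0"
  unfolding mu_def
  by (auto intro!: divide_nonneg_nonneg cInf_greatest spectral_norm_nonneg)

lemma mu_le:
  fixes A :: "complex ^ 'n ^ 'n"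
  assumes "g \<ge> 0" and "\<And>\<Delta>. \<Delta> \<in> D \<Longrightarrow> det (mat 1 - A ** \<Delta>) = 0 \<Longrightarrow> 1 \<le> g * spectral_norm \<Delta>"
  shows "mu A D \<le> g"
proof (cases "\<exists>\<Delta>\<in>D. det (mat 1 - A ** \<Delta>) = 0")
  case True
  let ?S = "{spectral_norm \<Delta> |\<Delta>. \<Delta> \<in> D \<and> det (mat 1 - A ** \<Delta>) = 0}"
  \<comment> \<open>For a singular perturbation, \<open>g = 0\<close> would turn the assumption into
    \<open>1 \<le> 0\<close>.\<close>
  have "g \<noteq> 0" using True assms(2) by force
  then have g: "g > 0" using assms(1) by simp
  have "1 / g \<le> Inf ?S"
    using True g assms(2) by (intro cInf_greatest) (auto simp: field_simps)
  then have "1 / Inf ?S \<le> g" using g by (smt (verit) divide_pos_pos le_divide_eq mult.commute pos_divide_le_eq)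
  then show ?thesis using True by (simp add: mu_def)
next
  case False
  then show ?thesis using assms(1) by (simp add: mu_def)
qed

text \<open>The infimum in \<^const>\<open>mu\<close> is positive, so its reciprocal is not the junk value \<open>1/0\<close>.\<close>

lemma mu_ge:
  fixes A :: "complex ^ 'n ^ 'n"
  assumes "c > 0" and "\<Delta> \<in> D" and "det (mat 1 - A ** \<Delta>) = 0" and "spectral_norm \<Delta> \<le> 1 / c"
  shows "c \<le> mu A D"
proof -
  let ?S = "{spectral_norm \<Delta> |\<Delta>. \<Delta> \<in> D \<and> det (mat 1 - A ** \<Delta>) = 0}"
  define a where "a = spectral_norm A"
  have a: "a > 0"
    using spectral_norm_mult_ge_1[OF assms(3)] spectral_norm_nonneg[of A]
    by (cases "spectral_norm A = 0") (auto simp: a_def)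
  have "1 / a \<le> Inf ?S"
    using assms(2,3) a spectral_norm_mult_ge_1[of A]
    by (intro cInf_greatest) (auto simp: a_def field_simps)
  then have pos: "Inf ?S > 0" using a by (smt (verit) divide_pos_pos)
  have "bdd_below ?S" by (rule bdd_belowI[of _ 0]) (auto simp: spectral_norm_nonneg)
  then have "Inf ?S \<le> spectral_norm \<Delta>" using assms(2,3) by (intro cInf_lower) auto
  then have "Inf ?S \<le> 1 / c" using assms(4) by simp
  then have "c \<le> 1 / Inf ?S" using pos assms(1) by (simp add: field_simps)
  then show ?thesis using assms(2,3) by (auto simp: mu_def)
qed

section \<open>Block scalings of nonnegative matrices\<close>

text \<open>Minkowski's inequality in the plane, with the summands \<open>p j * (sqrt (s u j), sqrt (t v j))\<close>.\<close>

lemma sum_sqrt_square_concave: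
  fixes p u v :: "'a \<Rightarrow> real"
  assumes "\<And>j. p j \<ge> 0" "\<And>j. u j \<ge> 0" "\<And>j. v j \<ge> 0" "s \<ge> 0" "t \<ge> 0"
  shows "s * (\<Sum>j\<in>A. p j * sqrt (u j))\<^sup>2 + t * (\<Sum>j\<in>A. p j * sqrt (v j))\<^sup>2
    \<le> (\<Sum>j\<in>A. p j * sqrt (s * u j + t * v j))\<^sup>2"
proof -
  define w where "w j = Complex (p j * sqrt (s * u j)) (p j * sqrt (t * v j))" for j
  have n: "cmod (w j) = p j * sqrt (s * u j + t * v j)" for j
  proof -
    have "cmod (w j) = sqrt ((p j)\<^sup>2 * (s * u j + t * v j))"
      using assms by (simp add: w_def cmod_def power_mult_distrib algebra_simps)
    then show ?thesis using assms by (simp add: real_sqrt_mult)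
  qed
  have "s * (\<Sum>j\<in>A. p j * sqrt (u j))\<^sup>2 + t * (\<Sum>j\<in>A. p j * sqrt (v j))\<^sup>2
      = (Re (\<Sum>j\<in>A. w j))\<^sup>2 + (Im (\<Sum>j\<in>A. w j))\<^sup>2"
  proof -
    have "Re (\<Sum>j\<in>A. w j) = sqrt s * (\<Sum>j\<in>A. p j * sqrt (u j))"
      by (simp add: w_def real_sqrt_mult sum_distrib_left mult_ac)
    moreover have "Im (\<Sum>j\<in>A. w j) = sqrt t * (\<Sum>j\<in>A. p j * sqrt (v j))"
      by (simp add: w_def real_sqrt_mult sum_distrib_left mult_ac)
    ultimately show ?thesis using assms by (simp add: power_mult_distrib)
  qed
  also have "\<dots> = (cmod (\<Sum>j\<in>A. w j))\<^sup>2" by (simp add: cmod_power2)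
  also have "\<dots> \<le> (\<Sum>j\<in>A. cmod (w j))\<^sup>2"
    by (intro power_mono norm_sum) simp
  finally show ?thesis by (simp add: n)
qed

lemma compact_simplex: "compact {u :: real ^ 'n. (\<forall>k. 0 \<le> u $ k) \<and> (\<Sum>k\<in>UNIV. u $ k) = 1}"
  (is "compact ?S")
proof -
  have "norm u \<le> 1" if "u \<in> ?S" for u
    using that norm_le_l1_cart[of u] by simp
  then have "bounded ?S" by (auto simp: bounded_iff)
  moreover have "closed ?S"
    by (intro closed_Collect_conj closed_Collect_all closed_Collect_le closed_Collect_eq
        continuous_intros)
  ultimately show ?thesis by (simp add: compact_eq_bounded_closed)
qed

text \<open>A theorem of the alternative. Concavity makes the set \<open>C\<close> of points below
  some value of \<open>F\<close> convex. Either \<open>0\<close> lies in it, which gives the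
  witness, or a hyperplane separates it from \<open>0\<close>, and the normal gives the
  weights.\<close>

lemma block_scaling_dichotomy:
  fixes P :: "real ^ 'n ^ 'n" and blk :: "'n \<Rightarrow> 'b" and c :: real
  assumes P: "\<And>i j. P $ i $ j \<ge> 0"
  obtains (scaling) \<theta> where "\<And>k. \<theta> k > 0" "\<And>j k. blk j = blk k \<Longrightarrow> \<theta> j = \<theta> k"
      "\<And>x. (\<And>k. x $ k \<ge> 0) \<Longrightarrow>
        (\<Sum>k\<in>UNIV. \<theta> k * ((P *v x) $ k)\<^sup>2) \<le> c\<^sup>2 * (\<Sum>k\<in>UNIV. \<theta> k * (x $ k)\<^sup>2)"
    | (witness) x where "\<And>k. x $ k \<ge> 0" "x \<noteq> 0"
      "\<And>j. c\<^sup>2 * (\<Sum>k | blk k = blk j. (x $ k)\<^sup>2) \<le> (\<Sum>k | blk k = blk j. ((P *v x) $ k)\<^sup>2)"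
proof -
  define g where "g u k = (\<Sum>j\<in>UNIV. P $ k $ j * sqrt (u $ j))\<^sup>2 - c\<^sup>2 * u $ k"
    for u :: "real ^ 'n" and k
  \<comment> \<open>The block sums are indexed by coordinates, so that each block is repeated once
    per coordinate; this keeps the argument in \<open>real ^ 'n\<close>.\<close>
  define F where "F u = (\<chi> j. \<Sum>k | blk k = blk j. g u k)" for u
  define S where "S = {u :: real ^ 'n. (\<forall>k. 0 \<le> u $ k) \<and> (\<Sum>k\<in>UNIV. u $ k) = 1}"
  \<comment> \<open>Adding the nonpositive orthant turns concavity of \<open>F\<close> into
    convexity of \<open>C\<close>; \<open>C\<close> is closed as the sum of a compact and a closed
    set.\<close>
  define N where "N = {y :: real ^ 'n. \<forall>k. y $ k \<le> 0}"
  define C where "C = (\<Union>x\<in>F ` S. \<Union>y\<in>N. {x + y})"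
  have S: "compact S" unfolding S_def by (rule compact_simplex)
  have contg: "continuous_on S (\<lambda>u. g u k)" for k
    unfolding g_def by (intro continuous_intros)
  have contF: "continuous_on S F"
    unfolding F_def by (intro continuous_on_vec_lambda continuous_on_sum contg)
  have "closed N" unfolding N_def
    by (intro closed_Collect_all closed_Collect_le continuous_intros)
  then have closed: "closed C"
    unfolding C_def by (intro compact_closed_sums compact_continuous_image contF S)
  have CI: "F u + y \<in> C" if "u \<in> S" "y \<in> N" for u y
    using that by (auto simp: C_def)
  have concave: "s * g u k + t * g v k \<le> g (s *\<^sub>R u + t *\<^sub>R v) k"
    if "u \<in> S" "v \<in> S" "s \<ge> 0" "t \<ge> 0" for u v s t k
    using sum_sqrt_square_concave[of "\<lambda>j. P $ k $ j" "\<lambda>j. u $ j" "\<lambda>j. v $ j" s t UNIV] that P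
    by (simp add: g_def S_def algebra_simps)
  have "convex C"
  proof (rule convexI)
    fix a b and s t :: real
    assume "a \<in> C" "b \<in> C" and st: "0 \<le> s" "0 \<le> t" "s + t = 1"
    then obtain u y v z where a: "a = F u + y" "u \<in> S" "y \<in> N" and b: "b = F v + z" "v \<in> S" "z \<in> N"
      by (auto simp: C_def)
    define w where "w = s *\<^sub>R u + t *\<^sub>R v"
    have "w \<in> S"
      using a b st by (simp add: w_def S_def sum.distrib flip: sum_distrib_left)
    moreover have "s *\<^sub>R a + t *\<^sub>R b - F w \<in> N"
      unfolding N_def
    proof (intro CollectI allI)
      fix j
      have "(s *\<^sub>R F u + t *\<^sub>R F v) $ j = (\<Sum>k | blk k = blk j. s * g u k + t * g v k)"
        by (simp add: F_def sum.distrib sum_distrib_left)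
      also have "\<dots> \<le> F w $ j"
        unfolding F_def w_def using a(2) b(2) st by (auto intro!: sum_mono concave)
      finally have "s * F u $ j + t * F v $ j \<le> F w $ j" by simp
      moreover have "s * y $ j \<le> 0" "t * z $ j \<le> 0"
        using a b st by (auto simp: N_def mult_nonneg_nonpos)
      ultimately show "(s *\<^sub>R a + t *\<^sub>R b - F w) $ j \<le> 0"
        by (simp add: a(1) b(1) algebra_simps)
    qed
    ultimately show "s *\<^sub>R a + t *\<^sub>R b \<in> C"
      using CI[of w "s *\<^sub>R a + t *\<^sub>R b - F w"] by simp
  qed
  show thesis
  proof (cases "0 \<in> C")
    case True
    then obtain u y where u: "u \<in> S" "y \<in> N" "F u + y = 0" by (auto simp: C_def)
    define x :: "real ^ 'n" where "x = (\<chi> k. sqrt (u $ k))"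
    have "x \<noteq> 0"
    proof
      assume "x = 0"
      then have "u $ k = 0" for k
        by (metis real_sqrt_eq_zero_cancel_iff vec_lambda_beta x_def zero_index)
      then show False using u(1) by (simp add: S_def)
    qed
    moreover have "c\<^sup>2 * (\<Sum>k | blk k = blk j. (x $ k)\<^sup>2) \<le> (\<Sum>k | blk k = blk j. ((P *v x) $ k)\<^sup>2)" for j
    proof -
      have "F u $ j + y $ j = 0" using u(3) by (metis vector_add_component zero_index)
      then have "0 \<le> F u $ j" using u(2) by (auto simp: N_def) (smt (verit))
      then show ?thesis
        using u(1) by (simp add: F_def g_def x_def matrix_vector_mult_def S_def sum_subtractf
            sum_distrib_left)
    qed
    ultimately show ?thesis using u(1) witness[of x] by (simp add: x_def S_def)
  next
    case False
    then obtain a b where b: "b > 0" and a: "\<And>z. z \<in> C \<Longrightarrow> a \<bullet> z > b"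
      using separating_hyperplane_closed_0[OF \<open>convex C\<close> closed] by blast
    define u0 :: "real ^ 'n" where "u0 = axis undefined 1"
    have u0: "u0 \<in> S" by (auto simp: u0_def S_def axis_def)
    \<comment> \<open>\<open>C\<close> is unbounded downwards in every coordinate, so a positive
      entry of \<open>a\<close> would let \<open>a \<bullet> z\<close> fall below
      \<open>b\<close>.\<close>
    have aneg: "a $ j \<le> 0" for j
    proof (rule ccontr)
      assume "\<not> a $ j \<le> 0"
      then have p: "a $ j > 0" by simp
      define r where "r = \<bar>a \<bullet> F u0\<bar> / a $ j"
      have "F u0 + axis j (- r) \<in> C"
        using u0 p by (intro CI) (auto simp: N_def axis_def r_def)
      then have "b < a \<bullet> (F u0 + axis j (- r))" by (rule a)
      also have "\<dots> = a \<bullet> F u0 - \<bar>a \<bullet> F u0\<bar>"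
        using p by (simp add: inner_add_right inner_axis r_def)
      finally show False using b by simp
    qed
    \<comment> \<open>Summing \<open>- a\<close> over a block collects the repeated copies and gives
      weights constant on blocks.\<close>
    define \<theta>0 where "\<theta>0 k = (\<Sum>j | blk j = blk k. - a $ j)" for k
    have \<theta>0: "\<theta>0 k \<ge> 0" for k unfolding \<theta>0_def using aneg by (simp add: sum_nonneg)
    have sep: "(\<Sum>k\<in>UNIV. \<theta>0 k * g u k) < - b" if "u \<in> S" for u
    proof -
      have "F u \<in> C" using CI[of u 0] that by (simp add: N_def)
      then have "b < a \<bullet> F u" by (rule a)
      also have "a \<bullet> F u = (\<Sum>j\<in>UNIV. \<Sum>k | blk k = blk j. a $ j * g u k)"
        by (simp add: inner_vec_def F_def sum_distrib_left)
      also have "\<dots> = (\<Sum>k\<in>UNIV. \<Sum>j | blk k = blk j. a $ j * g u k)"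
        using sum.swap_restrict[of UNIV UNIV "\<lambda>j k. a $ j * g u k" "\<lambda>j k. blk k = blk j"] by simp
      also have "\<dots> = - (\<Sum>k\<in>UNIV. \<theta>0 k * g u k)"
        by (simp add: \<theta>0_def sum_distrib_right sum_negf eq_commute[of "blk _" "blk _"])
      finally show ?thesis by simp
    qed
    \<comment> \<open>Some \<open>\<theta>0 k\<close> may be zero. The gap \<open>b\<close> leaves
      room to add \<open>\<epsilon>\<close> to every weight, since the sum of the
      \<open>g u k\<close> is bounded above on the compact set \<open>S\<close>.\<close>
    have "continuous_on S (\<lambda>u. \<Sum>k\<in>UNIV. g u k)" by (intro continuous_on_sum contg)
    then obtain v where v: "\<And>u. u \<in> S \<Longrightarrow> (\<Sum>k\<in>UNIV. g u k) \<le> (\<Sum>k\<in>UNIV. g v k)"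
      using continuous_attains_sup[of S "\<lambda>u. \<Sum>k\<in>UNIV. g u k"] S u0 by blast
    define B where "B = \<bar>\<Sum>k\<in>UNIV. g v k\<bar> + 1"
    define \<epsilon> where "\<epsilon> = b / B"
    have \<epsilon>: "\<epsilon> > 0" "\<epsilon> * B = b" using b by (auto simp: \<epsilon>_def B_def)
    define \<theta> where "\<theta> k = \<theta>0 k + \<epsilon>" for k
    have neg: "(\<Sum>k\<in>UNIV. \<theta> k * g u k) \<le> 0" if "u \<in> S" for u
    proof -
      have "(\<Sum>k\<in>UNIV. \<theta> k * g u k) = (\<Sum>k\<in>UNIV. \<theta>0 k * g u k) + \<epsilon> * (\<Sum>k\<in>UNIV. g u k)"
        by (simp add: \<theta>_def algebra_simps sum.distrib sum_distrib_left)
      also have "\<dots> \<le> - b + \<epsilon> * B"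
        using sep[OF that] v[OF that] \<epsilon> by (intro add_mono mult_left_mono) (auto simp: B_def)
      finally show ?thesis using \<epsilon> by simp
    qed
    have "(\<Sum>k\<in>UNIV. \<theta> k * ((P *v x) $ k)\<^sup>2) \<le> c\<^sup>2 * (\<Sum>k\<in>UNIV. \<theta> k * (x $ k)\<^sup>2)"
      if x: "\<And>k. x $ k \<ge> 0" for x
    proof (cases "x = 0")
      case True
      then show ?thesis by simp
    next
      case False
      define r where "r = (norm x)\<^sup>2"
      have r: "r > 0" using False by (simp add: r_def)
      have r_eq: "r = (\<Sum>k\<in>UNIV. (x $ k)\<^sup>2)"
          unfolding r_def power2_norm_eq_inner by (simp add: inner_vec_def power2_eq_square)
      \<comment> \<open>Normalised squares: homogeneity carries the inequality from the simplex to
        all \<open>x \<ge> 0\<close>.\<close>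
      define u :: "real ^ 'n" where "u = (\<chi> k. (x $ k)\<^sup>2 / r)"
      have "u \<in> S" using r by (simp add: S_def u_def r_eq sum_divide_distrib[symmetric])
      have g: "g u k = (((P *v x) $ k)\<^sup>2 - c\<^sup>2 * (x $ k)\<^sup>2) / r" for k
      proof -
        have "(\<Sum>j\<in>UNIV. P $ k $ j * sqrt (u $ j)) = (P *v x) $ k / sqrt r"
          using x by (simp add: u_def real_sqrt_divide matrix_vector_mult_def sum_divide_distrib)
        then show ?thesis using r by (simp add: g_def u_def power_divide diff_divide_distrib)
      qed
      have "(\<Sum>k\<in>UNIV. \<theta> k * g u k)
          = ((\<Sum>k\<in>UNIV. \<theta> k * ((P *v x) $ k)\<^sup>2) - c\<^sup>2 * (\<Sum>k\<in>UNIV. \<theta> k * (x $ k)\<^sup>2)) / r"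
        by (simp add: g sum_divide_distrib[symmetric] sum_distrib_left sum_subtractf[symmetric]
            algebra_simps)
      with neg[OF \<open>u \<in> S\<close>] r show ?thesis by (simp add: divide_le_0_iff)
    qed
    moreover have "\<theta> k > 0" for k using \<theta>0[of k] \<epsilon> by (simp add: \<theta>_def)
    moreover have "\<theta> j = \<theta> k" if "blk j = blk k" for j k
      using that by (simp add: \<theta>_def \<theta>0_def)
    ultimately show ?thesis using scaling[of \<theta>] by blast
  qed
qed

section \<open>Eigenvectors of nonnegative matrices\<close>

lemma nonneg_matrix_vector_mono:
  fixes Q :: "real ^ 'n ^ 'm"
  assumes "\<And>i j. Q $ i $ j \<ge> 0" "\<And>k. u $ k \<le> v $ k"
  shows "(Q *v u) $ i \<le> (Q *v v) $ i"
  by (simp add: matrix_vector_mult_def sum_mono mult_left_mono assms)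

text \<open>The set \<open>K\<close> of normalised supersolutions is convex and invariant, so that Brouwer's theorem yields an
  eigenvector in it.\<close>

lemma nonneg_matrix_eigenvector:
  fixes Q :: "real ^ 'n ^ 'n"
  assumes Q: "\<And>i j. Q $ i $ j \<ge> 0" and x: "\<And>k. x $ k \<ge> 0" "x \<noteq> 0"
    and Qx: "\<And>k. x $ k \<le> (Q *v x) $ k"
  obtains y l where "y \<noteq> 0" "l \<ge> 1" "Q *v y = l *\<^sub>R y"
proof -
  define S where "S = {u :: real ^ 'n. (\<forall>k. 0 \<le> u $ k) \<and> (\<Sum>k\<in>UNIV. u $ k) = 1}"
  define K where "K = S \<inter> {y. \<forall>k. y $ k \<le> (Q *v y) $ k}"
  define \<sigma> where "\<sigma> y = (\<Sum>k\<in>UNIV. y $ k)" for y :: "real ^ 'n"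
  have lin: "(Q *v y) $ k = (\<Sum>j\<in>UNIV. Q $ k $ j * y $ j)" for y k
    by (simp add: matrix_vector_mult_def)
  have compact: "compact K"
    unfolding K_def lin
    by (intro compact_Int_closed closed_Collect_all closed_Collect_le continuous_intros)
      (simp add: S_def compact_simplex)
  have "convex K"
  proof (rule convexI)
    fix u v and s t :: real
    assume *: "u \<in> K" "v \<in> K" "0 \<le> s" "0 \<le> t" "s + t = 1"
    then have "s * u $ k + t * v $ k \<le> s * (Q *v u) $ k + t * (Q *v v) $ k" for k
      by (intro add_mono mult_left_mono) (auto simp: K_def)
    then show "s *\<^sub>R u + t *\<^sub>R v \<in> K"
      using * by (simp add: K_def S_def sum.distrib matrix_vector_right_distrib
          matrix_vector_mult_scaleR flip: sum_distrib_left)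
  qed
  have normalise: "inverse (\<sigma> y) *\<^sub>R y \<in> K"
    if "\<And>k. y $ k \<ge> 0" "\<sigma> y > 0" "\<And>k. y $ k \<le> (Q *v y) $ k" for y
    using that by (simp add: K_def S_def \<sigma>_def matrix_vector_mult_scaleR mult_left_mono
        flip: sum_distrib_left)
  have "\<sigma> x > 0"
  proof -
    obtain k where "x $ k \<noteq> 0" using x(2) by (auto simp: vec_eq_iff)
    then show ?thesis unfolding \<sigma>_def
      using x(1) by (intro sum_pos2[of _ k]) (auto simp: order_less_le)
  qed
  then have "K \<noteq> {}" using normalise[of x] x Qx by blast
  \<comment> \<open>This bound keeps the normalising factor finite and continuous on
    \<open>K\<close>, and later yields \<open>l \<ge> 1\<close>.\<close>
  have ge: "\<sigma> (Q *v y) \<ge> 1" if "y \<in> K" for y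
  proof -
    have "1 = \<sigma> y" using that by (simp add: K_def S_def \<sigma>_def)
    also have "\<dots> \<le> \<sigma> (Q *v y)" unfolding \<sigma>_def using that by (intro sum_mono) (simp add: K_def)
    finally show ?thesis .
  qed
  have "(\<lambda>y. inverse (\<sigma> (Q *v y)) *\<^sub>R (Q *v y)) \<in> K \<rightarrow> K"
  proof (intro funcsetI normalise)
    fix y k assume y: "y \<in> K"
    show "(Q *v y) $ k \<ge> 0" using y by (auto simp: K_def S_def) (meson order_trans)
    show "\<sigma> (Q *v y) > 0" using ge[OF y] by simp
    \<comment> \<open>Supersolutions are preserved: apply the monotone map \<open>Q\<close> to
      \<open>y \<le> Q *v y\<close>.\<close>
    show "(Q *v y) $ k \<le> (Q *v (Q *v y)) $ k"
      using y by (intro nonneg_matrix_vector_mono Q) (simp add: K_def)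
  qed
  moreover have "continuous_on K (\<lambda>y. inverse (\<sigma> (Q *v y)) *\<^sub>R (Q *v y))"
    using ge unfolding \<sigma>_def
    by (force intro!: continuous_intros matrix_vector_mult_linear_continuous_on)
  ultimately obtain y where y: "y \<in> K" "inverse (\<sigma> (Q *v y)) *\<^sub>R (Q *v y) = y"
    using brouwer[OF compact \<open>convex K\<close> \<open>K \<noteq> {}\<close>] by blast
  have "Q *v y = \<sigma> (Q *v y) *\<^sub>R (inverse (\<sigma> (Q *v y)) *\<^sub>R (Q *v y))"
    using ge[OF y(1)] by simp
  then have "Q *v y = \<sigma> (Q *v y) *\<^sub>R y" by (simp only: y(2))
  moreover have "y \<noteq> 0" using y(1) by (auto simp: K_def S_def)
  ultimately show thesis using ge[OF y(1)] that by blast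
qed

section \<open>Real matrices and vectors as complex ones\<close>

definition cmat :: "real ^ 'n ^ 'm \<Rightarrow> complex ^ 'n ^ 'm" where
  "cmat A = (\<chi> i j. of_real (A $ i $ j))"

definition cvec :: "real ^ 'n \<Rightarrow> complex ^ 'n" where
  "cvec x = (\<chi> i. of_real (x $ i))"

lemma cmat_cvec: "cmat A *v cvec x = cvec (A *v x)"
  by (simp add: cmat_def cvec_def matrix_vector_mult_def vec_eq_iff)

lemma norm_cvec: "norm (cvec x) = norm x"
  by (simp add: cvec_def norm_vec_def)

text \<open>Passing to entrywise moduli keeps the norm of a vector, and the image under
  \<open>P\<close> is at least as long, so nonnegative test vectors suffice.\<close>

lemma spectral_norm_le_dominated:
  fixes A :: "complex ^ 'n ^ 'm" and P :: "real ^ 'n ^ 'm"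
  assumes "\<And>i j. cmod (A $ i $ j) \<le> P $ i $ j" "c \<ge> 0"
    and "\<And>x. (\<And>k. x $ k \<ge> 0) \<Longrightarrow> norm (P *v x) \<le> c * norm x"
  shows "spectral_norm A \<le> c"
proof (rule spectral_norm_le)
  fix v :: "complex ^ 'n"
  have "norm (A *v v) \<le> norm (P *v (\<chi> i. cmod (v $ i)))"
    using assms(1) by (rule norm_matrix_vector_dominated)
  also have "\<dots> \<le> c * norm (\<chi> i. cmod (v $ i))" by (rule assms(3)) simp
  also have "norm (\<chi> i. cmod (v $ i)) = norm v" by (simp add: norm_vec_def)
  finally show "norm (A *v v) \<le> c * norm v" .
qed (rule assms)

lemma spectral_norm_mono:
  fixes A :: "complex ^ 'n ^ 'm" and P :: "real ^ 'n ^ 'm"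
  assumes "\<And>i j. cmod (A $ i $ j) \<le> P $ i $ j"
  shows "spectral_norm A \<le> spectral_norm (cmat P)"
  using assms spectral_norm_nonneg
proof (rule spectral_norm_le_dominated)
  fix x :: "real ^ 'n"
  show "norm (P *v x) \<le> spectral_norm (cmat P) * norm x"
    using norm_matrix_vector_le_spectral_norm[of "cmat P" "cvec x"] by (simp add: cmat_cvec norm_cvec)
qed

section \<open>Diagonal scalings\<close>

definition diag_scale :: "('n \<Rightarrow> real) \<Rightarrow> complex ^ 'n ^ 'n \<Rightarrow> complex ^ 'n ^ 'n" where
  "diag_scale \<theta> A = (\<chi> i j. of_real (\<theta> i powr (1/2)) * A $ i $ j * of_real (\<theta> j powr - (1/2)))"

lemma diag_powr_conjugate:
  "diag_powr (\<chi> j k. if j = k then of_real (\<theta> j) else 0) (1/2) ** A **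
   diag_powr (\<chi> j k. if j = k then of_real (\<theta> j) else 0) (- 1/2) = diag_scale \<theta> A"
  by (simp add: diag_powr_def diag_scale_def matrix_matrix_mult_def vec_eq_iff
      if_distrib if_distribR sum.delta sum.delta' cong: if_cong)

text \<open>The condition on nonzero entries says that each \<open>\<Delta>\<close> commutes with
  the scaling. Conjugating \<open>A\<close> therefore preserves singularity with the same
  \<open>\<Delta>\<close>, and monotonicity of the norm then replaces \<open>A\<close> by
  \<open>P\<close>.\<close>

lemma mu_le_diag_scale:
  fixes A :: "complex ^ 'n ^ 'n" and P :: "real ^ 'n ^ 'n"
  assumes dom: "\<And>i j. cmod (A $ i $ j) \<le> P $ i $ j" and \<theta>: "\<And>k. \<theta> k > 0"
    and comm: "\<And>\<Delta> j k. \<Delta> \<in> D \<Longrightarrow> \<Delta> $ j $ k \<noteq> 0 \<Longrightarrow> \<theta> j = \<theta> k"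
  shows "mu A D \<le> spectral_norm (diag_scale \<theta> (cmat P))"
proof (rule mu_le[OF spectral_norm_nonneg])
  fix \<Delta> assume \<Delta>: "\<Delta> \<in> D" "det (mat 1 - A ** \<Delta>) = 0"
  then obtain v where v: "v \<noteq> 0" "A *v (\<Delta> *v v) = v"
    by (auto simp: det_zero_kernel matrix_vector_mul_assoc)
  \<comment> \<open>The fixed vector \<open>v\<close> of \<open>A ** \<Delta>\<close>, scaled by the
    square root of the weights, is fixed by
    \<open>diag_scale \<theta> A ** \<Delta>\<close>.\<close>
  define y :: "complex ^ 'n" where "y = (\<chi> i. of_real (\<theta> i powr (1/2)) * v $ i)"
  have \<Delta>y: "(\<Delta> *v y) $ j = of_real (\<theta> j powr (1/2)) * (\<Delta> *v v) $ j" for j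
  proof -
    have "\<Delta> $ j $ k * (of_real (\<theta> k powr (1/2)) * v $ k) =
        of_real (\<theta> j powr (1/2)) * (\<Delta> $ j $ k * v $ k)" for k
      using comm[OF \<Delta>(1), of j k] by (cases "\<Delta> $ j $ k = 0") auto
    then show ?thesis
      unfolding y_def matrix_vector_mult_def vec_lambda_beta sum_distrib_left by (intro sum.cong refl)
  qed
  have inv: "of_real (\<theta> j powr - (1/2)) * (of_real (\<theta> j powr (1/2)) * z) = z" for j and z :: complex
  proof -
    have "\<theta> j powr - (1/2) * \<theta> j powr (1/2) = 1" using \<theta>[of j] by (simp flip: powr_add)
    then show ?thesis by (metis mult.assoc mult_1 of_real_1 of_real_mult)
  qed
  have "diag_scale \<theta> A *v (\<Delta> *v y) = y"
  proof -
    have "(diag_scale \<theta> A *v (\<Delta> *v y)) $ i = y $ i" for i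
    proof -
      have "(diag_scale \<theta> A *v (\<Delta> *v y)) $ i
          = (\<Sum>j\<in>UNIV. of_real (\<theta> i powr (1/2)) * (A $ i $ j * (\<Delta> *v v) $ j))"
        unfolding matrix_vector_mult_def[of "diag_scale \<theta> A"]
        by (simp add: \<Delta>y diag_scale_def mult.assoc inv)
      also have "\<dots> = of_real (\<theta> i powr (1/2)) * (A *v (\<Delta> *v v)) $ i"
        by (simp add: matrix_vector_mult_def[of A] sum_distrib_left)
      finally show ?thesis by (simp add: v(2) y_def)
    qed
    then show ?thesis by (simp add: vec_eq_iff)
  qed
  moreover have "y \<noteq> 0"
  proof -
    obtain k where "v $ k \<noteq> 0" using v(1) by (auto simp: vec_eq_iff)
    then show ?thesis using \<theta>[of k] by (auto simp: y_def vec_eq_iff intro!: exI[of _ k])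
  qed
  ultimately have "det (mat 1 - diag_scale \<theta> A ** \<Delta>) = 0"
    by (auto simp: det_zero_kernel simp flip: matrix_vector_mul_assoc)
  then have "1 \<le> spectral_norm (diag_scale \<theta> A) * spectral_norm \<Delta>"
    by (rule spectral_norm_mult_ge_1)
  also have "spectral_norm (diag_scale \<theta> A)
      \<le> spectral_norm (cmat (\<chi> i j. \<theta> i powr (1/2) * P $ i $ j * \<theta> j powr - (1/2)))"
    using dom by (intro spectral_norm_mono)
      (simp add: diag_scale_def norm_mult mult_left_mono mult_right_mono)
  also have "cmat (\<chi> i j. \<theta> i powr (1/2) * P $ i $ j * \<theta> j powr - (1/2)) = diag_scale \<theta> (cmat P)"
    by (simp add: cmat_def diag_scale_def vec_eq_iff)
  finally show "1 \<le> spectral_norm (diag_scale \<theta> (cmat P)) * spectral_norm \<Delta>"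
    by (simp add: mult_right_mono spectral_norm_nonneg)
qed

text \<open>Substituting \<open>x $ j = \<theta> j powr - (1/2) * y $ j\<close> turns the weighted
  inequality into a norm bound on nonnegative \<open>y\<close>.\<close>

lemma spectral_norm_diag_scale_le:
  fixes P :: "real ^ 'n ^ 'n"
  assumes P: "\<And>i j. P $ i $ j \<ge> 0" and \<theta>: "\<And>k. \<theta> k > 0" and c: "c \<ge> 0"
    and le: "\<And>x. (\<And>k. x $ k \<ge> 0) \<Longrightarrow>
      (\<Sum>k\<in>UNIV. \<theta> k * ((P *v x) $ k)\<^sup>2) \<le> c\<^sup>2 * (\<Sum>k\<in>UNIV. \<theta> k * (x $ k)\<^sup>2)"
  shows "spectral_norm (diag_scale \<theta> (cmat P)) \<le> c"
proof (rule spectral_norm_le_dominated[OF _ c])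
  let ?S = "(\<chi> i j. \<theta> i powr (1/2) * P $ i $ j * \<theta> j powr - (1/2)) :: real ^ 'n ^ 'n"
  show "cmod (diag_scale \<theta> (cmat P) $ i $ j) \<le> ?S $ i $ j" for i j
    using P[of i j] by (simp add: diag_scale_def cmat_def norm_mult)
  fix y :: "real ^ 'n" assume y: "\<And>k. y $ k \<ge> 0"
  define x :: "real ^ 'n" where "x = (\<chi> j. \<theta> j powr - (1/2) * y $ j)"
  have n2: "(norm z)\<^sup>2 = (\<Sum>k\<in>UNIV. (z $ k)\<^sup>2)" for z :: "real ^ 'n"
    unfolding power2_norm_eq_inner by (simp add: inner_vec_def power2_eq_square)
  have half: "(\<theta> k powr (1/2))\<^sup>2 = \<theta> k" "\<theta> k * (\<theta> k powr - (1/2))\<^sup>2 = 1" for k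
    using \<theta>[of k] by (simp_all add: power2_eq_square powr_minus_divide flip: powr_add)
  have "(norm (?S *v y))\<^sup>2 = (\<Sum>k\<in>UNIV. \<theta> k * ((P *v x) $ k)\<^sup>2)"
  proof -
    have "(?S *v y) $ k = \<theta> k powr (1/2) * (P *v x) $ k" for k
      by (simp add: matrix_vector_mult_def x_def sum_distrib_left mult_ac)
    then show ?thesis by (simp add: n2 power_mult_distrib half)
  qed
  also have "\<dots> \<le> c\<^sup>2 * (\<Sum>k\<in>UNIV. \<theta> k * (x $ k)\<^sup>2)"
    using y by (intro le) (simp add: x_def)
  also have "(\<Sum>k\<in>UNIV. \<theta> k * (x $ k)\<^sup>2) = (norm y)\<^sup>2"
    by (simp add: n2 x_def power_mult_distrib half flip: mult.assoc)
  finally have "(norm (?S *v y))\<^sup>2 \<le> (c * norm y)\<^sup>2" by (simp add: power_mult_distrib)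
  then show "norm (?S *v y) \<le> c * norm y" by (rule power2_le_imp_le) (simp add: c)
qed

section \<open>Construction of a singular perturbation\<close>

text \<open>On full blocks \<open>D\<close> is the rank one matrix that maps the restriction of \<open>P *v x\<close> to that of \<open>x\<close>;
  dividing \<open>D\<close> by an eigenvalue of \<open>D ** P\<close> that is at least \<open>1\<close> keeps all scalar entries equal, so
  that the result also has repeated scalar blocks.\<close>

lemma singular_perturbation_exists:
  fixes P :: "real ^ 'n ^ 'n" and blk :: "'n \<Rightarrow> 'b" and full :: "'n \<Rightarrow> bool"
  assumes P: "\<And>i j. P $ i $ j \<ge> 0" and c: "c > 0" and x: "\<And>k. x $ k \<ge> 0" "x \<noteq> 0"
    and wit: "\<And>j. c\<^sup>2 * (\<Sum>k | blk k = blk j. (x $ k)\<^sup>2) \<le> (\<Sum>k | blk k = blk j. ((P *v x) $ k)\<^sup>2)"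
    and full: "\<And>j k. blk j = blk k \<Longrightarrow> full j = full k"
    and scalar: "\<And>j k. blk j = blk k \<Longrightarrow> \<not> full j \<Longrightarrow> j = k"
  obtains E d where "d \<ge> 0" "\<And>j k. E $ j $ k \<ge> 0"
    "\<And>j k. blk j \<noteq> blk k \<Longrightarrow> E $ j $ k = 0"
    "\<And>j. \<not> full j \<Longrightarrow> E $ j $ j = d"
    "spectral_norm (cmat E) \<le> 1 / c" "det (mat 1 - cmat P ** cmat E) = 0"
proof -
  define w where "w = P *v x"
  define n where "n j = (\<Sum>k | blk k = blk j. (w $ k)\<^sup>2)" for j
  \<comment> \<open>If \<open>n j = 0\<close>, division by zero makes the row vanish; the witness
    inequality then forces \<open>x\<close> to vanish on that block too.\<close>
  define D :: "real ^ 'n ^ 'n" where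
    "D = (\<chi> j k. if full j then (if blk k = blk j then x $ j * w $ k / n j else 0)
                 else (if k = j then 1 / c else 0))"
  \<comment> \<open>Weights for bounding the norm of \<open>D\<close>: by Cauchy-Schwarz,
    \<open>((D *v y) $ j)^2\<close> is at most the \<open>h j\<close>-weighted sum of the
    \<open>(y $ k)^2\<close>, and by \<open>wit\<close> the columns of \<open>h\<close> sum to at
    most \<open>1 / c^2\<close>.\<close>
  define h where
    "h j k = (if full j then (if blk j = blk k then (x $ j)\<^sup>2 / n j else 0)
              else (if j = k then 1 / c\<^sup>2 else 0))" for j k
  have w: "w $ k \<ge> 0" for k
    by (simp add: w_def matrix_vector_mult_def P x sum_nonneg)
  have n: "n j \<ge> 0" for j by (simp add: n_def sum_nonneg)
  have D: "D $ j $ k \<ge> 0" for j k using x(1)[of j] w[of k] n[of j] c by (auto simp: D_def)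
  have Dfull: "(D *v y) $ j = x $ j * (\<Sum>k | blk k = blk j. w $ k * y $ k) / n j" if "full j" for y j
  proof -
    have "(D *v y) $ j = (\<Sum>k\<in>UNIV. D $ j $ k * y $ k)"
      by (simp add: matrix_vector_mult_def)
    also have "\<dots> = (\<Sum>k\<in>UNIV. if blk k = blk j then x $ j * w $ k / n j * y $ k else 0)"
      using that by (intro sum.cong) (auto simp: D_def)
    also have "\<dots> = (\<Sum>k | blk k = blk j. x $ j * w $ k / n j * y $ k)"
      by (simp add: sum.If_cases)
    finally show ?thesis by (simp add: sum_distrib_left sum_divide_distrib mult_ac)
  qed
  have Dscalar: "(D *v y) $ j = y $ j / c" if "\<not> full j" for y j
  proof -
    have "(D *v y) $ j = (\<Sum>k\<in>UNIV. D $ j $ k * y $ k)"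
      by (simp add: matrix_vector_mult_def)
    also have "\<dots> = (\<Sum>k\<in>UNIV. if k = j then y $ k / c else 0)"
      using that by (intro sum.cong) (auto simp: D_def)
    finally show ?thesis by simp
  qed
  have row: "((D *v y) $ j)\<^sup>2 \<le> (\<Sum>k\<in>UNIV. h j k * (y $ k)\<^sup>2)" for y j
  proof (cases "full j")
    case True
    have "(\<Sum>k | blk k = blk j. w $ k * y $ k)\<^sup>2 \<le> n j * (\<Sum>k | blk k = blk j. (y $ k)\<^sup>2)"
      unfolding n_def by (rule Cauchy_Schwarz_ineq_sum)
    then have "(x $ j)\<^sup>2 / (n j)\<^sup>2 * (\<Sum>k | blk k = blk j. w $ k * y $ k)\<^sup>2
        \<le> (x $ j)\<^sup>2 / (n j)\<^sup>2 * (n j * (\<Sum>k | blk k = blk j. (y $ k)\<^sup>2))"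
      by (rule mult_left_mono) simp
    also have "\<dots> = (x $ j)\<^sup>2 / n j * (\<Sum>k | blk k = blk j. (y $ k)\<^sup>2)"
      by (simp add: power2_eq_square)
    also have "\<dots> = (\<Sum>k\<in>UNIV. if blk k = blk j then (x $ j)\<^sup>2 / n j * (y $ k)\<^sup>2 else 0)"
      by (simp add: sum.If_cases sum_distrib_left)
    also have "\<dots> = (\<Sum>k\<in>UNIV. h j k * (y $ k)\<^sup>2)"
      using True by (intro sum.cong) (auto simp: h_def)
    finally show ?thesis using True by (simp add: Dfull power_divide power_mult_distrib)
  next
    case False
    then have "(\<Sum>k\<in>UNIV. h j k * (y $ k)\<^sup>2) = (\<Sum>k\<in>UNIV. if j = k then (y $ k)\<^sup>2 / c\<^sup>2 else 0)"
      by (intro sum.cong) (auto simp: h_def)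
    then show ?thesis using False by (simp add: Dscalar power_divide)
  qed
  have column: "(\<Sum>j\<in>UNIV. h j k) \<le> 1 / c\<^sup>2" for k
  proof (cases "full k")
    case True
    have "(\<Sum>j\<in>UNIV. h j k) = (\<Sum>j\<in>UNIV. if blk j = blk k then (x $ j)\<^sup>2 / n k else 0)"
    proof (intro sum.cong refl)
      fix j
      show "h j k = (if blk j = blk k then (x $ j)\<^sup>2 / n k else 0)"
        using True full[of j k] by (cases "blk j = blk k") (auto simp: h_def n_def)
    qed
    also have "\<dots> = (\<Sum>j | blk j = blk k. (x $ j)\<^sup>2) / n k"
      by (simp add: sum.If_cases sum_divide_distrib)
    also have "\<dots> \<le> 1 / c\<^sup>2"
      using wit[of k] n[of k] c unfolding w_def[symmetric] n_def[symmetric]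
      by (cases "n k = 0") (auto simp: field_simps)
    finally show ?thesis .
  next
    case False
    then have "(\<Sum>j\<in>UNIV. h j k) = (\<Sum>j\<in>UNIV. if j = k then 1 / c\<^sup>2 else 0)"
    proof (intro sum.cong refl)
      fix j
      show "h j k = (if j = k then 1 / c\<^sup>2 else 0)"
        using False full[of j k] by (auto simp: h_def)
    qed
    then show ?thesis by simp
  qed
  have Dnorm: "norm (D *v y) \<le> norm y / c" for y
  proof -
    have n2: "(norm z)\<^sup>2 = (\<Sum>k\<in>UNIV. (z $ k)\<^sup>2)" for z :: "real ^ 'n"
      unfolding power2_norm_eq_inner by (simp add: inner_vec_def power2_eq_square)
    have "(norm (D *v y))\<^sup>2 \<le> (\<Sum>j\<in>UNIV. \<Sum>k\<in>UNIV. h j k * (y $ k)\<^sup>2)"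
      unfolding n2 by (intro sum_mono row)
    also have "\<dots> = (\<Sum>k\<in>UNIV. (\<Sum>j\<in>UNIV. h j k) * (y $ k)\<^sup>2)"
      by (subst sum.swap) (simp add: sum_distrib_right)
    also have "\<dots> \<le> (\<Sum>k\<in>UNIV. 1 / c\<^sup>2 * (y $ k)\<^sup>2)"
      by (intro sum_mono mult_right_mono column) simp
    also have "\<dots> = (norm y / c)\<^sup>2"
      by (simp add: n2 power_divide flip: sum_divide_distrib)
    finally show ?thesis by (rule power2_le_imp_le) (simp add: c less_imp_le)
  qed
  have DP: "(D ** P) *v x = D *v w" by (simp add: w_def matrix_vector_mul_assoc)
  have super: "x $ j \<le> ((D ** P) *v x) $ j" for j
  proof (cases "full j")
    case True
    have "x $ j = 0" if "n j = 0"
    proof -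
      have "c\<^sup>2 * (\<Sum>k | blk k = blk j. (x $ k)\<^sup>2) \<le> 0"
        using wit[of j] that by (simp add: n_def w_def)
      then have "(\<Sum>k | blk k = blk j. (x $ k)\<^sup>2) = 0"
        using c by (simp add: mult_le_0_iff sum_nonneg order_antisym)
      then show ?thesis by (simp add: sum_nonneg_eq_0_iff)
    qed
    moreover have "((D ** P) *v x) $ j = x $ j * n j / n j"
      unfolding DP Dfull[OF True] by (simp add: n_def power2_eq_square)
    ultimately show ?thesis by (cases "n j = 0") auto
  next
    case False
    \<comment> \<open>A scalar block is a singleton, so \<open>wit\<close> reduces to
      \<open>c * x $ j \<le> w $ j\<close>.\<close>
    have "k = j" if "blk k = blk j" for k using scalar[OF that[symmetric] False] by simp
    then have "{k. blk k = blk j} = {j}" by auto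
    then have "(c * x $ j)\<^sup>2 \<le> (w $ j)\<^sup>2" using wit[of j] by (simp add: w_def power_mult_distrib)
    then have "c * x $ j \<le> w $ j" using w by (rule power2_le_imp_le)
    then show ?thesis
      unfolding DP Dscalar[OF False] using c by (simp add: field_simps)
  qed
  have DP_nonneg: "(D ** P) $ i $ j \<ge> 0" for i j
    by (simp add: matrix_matrix_mult_def D P sum_nonneg)
  obtain y l where y: "y \<noteq> 0" "l \<ge> 1" "(D ** P) *v y = l *\<^sub>R y"
    by (rule nonneg_matrix_eigenvector[OF DP_nonneg x super])
  \<comment> \<open>Division by \<open>l\<close> makes \<open>E ** P\<close> fix \<open>y\<close>,
    so \<open>P ** E\<close> fixes \<open>P *v y\<close>; this is the order of factors in the
    determinant.\<close>
  define E where "E = (1 / l) *\<^sub>R D"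
  have Ev: "E *v z = (1 / l) *\<^sub>R (D *v z)" for z
    by (simp add: E_def scaleR_matrix_vector_assoc)
  define z where "z = P *v y"
  have "D *v z = l *\<^sub>R y" using y(3) by (simp add: z_def matrix_vector_mul_assoc)
  then have Ez: "E *v z = y" using y(2) by (simp add: Ev)
  have "norm (E *v u) \<le> 1 / c * norm u" for u
  proof -
    have "norm (E *v u) = norm (D *v u) / l" using y(2) by (simp add: Ev)
    also have "\<dots> \<le> norm (D *v u) / 1" using y(2) by (intro divide_left_mono) auto
    finally show ?thesis using Dnorm[of u] by simp
  qed
  then have E_norm: "spectral_norm (cmat E) \<le> 1 / c"
    using c D y(2) by (intro spectral_norm_le_dominated[where P = E]) (auto simp: cmat_def E_def norm_divide)
  have E_singular: "det (mat 1 - cmat P ** cmat E) = 0"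
  proof -
    have "(cmat P ** cmat E) *v cvec z = cvec z"
      by (simp add: cmat_cvec Ez flip: matrix_vector_mul_assoc) (simp add: z_def)
    moreover have "cvec z \<noteq> 0"
      using Ez y(1) by (metis matrix_vector_mult_0_right norm_cvec norm_eq_zero)
    ultimately show ?thesis by (auto simp: det_zero_kernel)
  qed
  show thesis
  proof (rule that[OF _ _ _ _ E_norm E_singular])
    show "1 / (l * c) \<ge> 0" using y(2) c by simp
    show "E $ j $ k \<ge> 0" for j k using D[of j k] y(2) by (simp add: E_def)
    show "E $ j $ k = 0" if "blk j \<noteq> blk k" for j k
      using that by (auto simp: E_def D_def)
    show "E $ j $ j = 1 / (l * c)" if "\<not> full j" for j
      using that by (simp add: E_def D_def)
  qed
qed

section \<open>Uncertainty blocks\<close>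

lemma card_atMost_inj: "card {..j} = card {..k} \<longleftrightarrow> j = (k :: 'm::{finite,linorder})"
proof
  assume *: "card {..j} = card {..k}"
  have "{..j} = {..k}"
  proof (cases j k rule: le_cases)
    case le
    then show ?thesis using * by (intro card_subset_eq) auto
  next
    case ge
    then show ?thesis using * by (intro card_subset_eq[symmetric]) auto
  qed
  then show "j = k" by (metis atMost_iff order_antisym order_refl)
qed simp

context
  fixes f s :: nat and msz :: "nat \<Rightarrow> nat"
  assumes total: "(\<Sum>i=1..f+s. msz i) = CARD('m::{finite,linorder})"
begin

lemma card_atMost_bounds: "1 \<le> card {..j}" "card {..j} \<le> CARD('m)" for j :: 'm
  by (auto simp: Suc_le_eq card_gt_0_iff card_mono)

text \<open>The empty sum is \<open>0\<close> while coordinate numbers start at \<open>1\<close>, so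
  the least index is never \<open>0\<close>.\<close>

lemma block_bounds:
  fixes j :: 'm
  shows "1 \<le> block msz j" "block msz j \<le> f + s"
proof -
  have *: "card {..j} \<le> (\<Sum>l=1..f+s. msz l)" using total card_atMost_bounds[of j] by simp
  show "block msz j \<le> f + s" unfolding block_def by (rule Least_le) (rule *)
  have "card {..j} \<le> (\<Sum>l=1..block msz j. msz l)" unfolding block_def by (rule LeastI) (rule *)
  then show "1 \<le> block msz j" using card_atMost_bounds(1)[of j] by (cases "block msz j") auto
qed

lemma block_gt_imp_card_gt: "f < block msz j \<Longrightarrow> (\<Sum>l=1..f. msz l) < card {..j}" for j :: 'm
  unfolding block_def by (metis (no_types, lifting) not_le not_less_Least)

text \<open>Full blocks keep their number; beyond them the truncated difference in
  \<open>split_block\<close> is positive.\<close>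

lemma split_block_le_iff: "split_block f msz j \<le> f \<longleftrightarrow> block msz j \<le> f" for j :: 'm
  using block_gt_imp_card_gt[of j] by (auto simp: split_block_def not_le)

lemma split_block_bounds: "split_block f msz j \<in> {1..f + sbar f s msz}" for j :: 'm
proof -
  have "(\<Sum>l=1..f+s. msz l) = (\<Sum>l=1..f. msz l) + sbar f s msz"
    unfolding sbar_def by (rule sum.ub_add_nat) simp
  then show ?thesis
    using block_bounds[of j] block_gt_imp_card_gt[of j] card_atMost_bounds(2)[of j] total
    by (auto simp: split_block_def)
qed

lemma split_block_scalar:
  fixes j k :: 'm
  assumes "split_block f msz j = split_block f msz k" "\<not> block msz j \<le> f"
  shows "j = k"
proof -
  have "\<not> block msz k \<le> f" using assms split_block_le_iff by metis
  then have "card {..j} = card {..k}"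
    using assms block_gt_imp_card_gt[of j] block_gt_imp_card_gt[of k]
    by (simp add: split_block_def)
  then show ?thesis by (simp add: card_atMost_inj)
qed

text \<open>Inside a full block the two numberings agree, and inside a repeated scalar block only
  diagonal entries can be nonzero.\<close>

lemma Delta_RC_commute:
  assumes "\<Delta> \<in> Delta_RC f s msz IR" "\<Delta> $ j $ k \<noteq> 0"
  shows "split_block f msz j = split_block f msz (k :: 'm)"
  using assms by (auto simp: Delta_RC_def split_block_def split: if_splits)

lemma Delta_plus_commute:
  assumes "\<Delta> \<in> Delta_plus f s msz" "\<Delta> $ j $ k \<noteq> 0"
  shows "split_block f msz j = split_block f msz (k :: 'm)"
  using assms by (auto simp: Delta_plus_def split: if_splits)

text \<open>One matrix serves both structures: equal scalar entries \<open>d\<close> respect the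
  repetition in \<open>Delta_RC\<close>, and real nonnegative entries are admissible whichever
  blocks are real.\<close>

lemma repeated_scalar_in_Delta:
  fixes E :: "real ^ 'm::_ ^ 'm::_"
  assumes "d \<ge> 0" "\<And>j k. E $ j $ k \<ge> 0"
    "\<And>j k. split_block f msz j \<noteq> split_block f msz k \<Longrightarrow> E $ j $ k = 0"
    "\<And>j. \<not> block msz j \<le> f \<Longrightarrow> E $ j $ j = d"
  shows "cmat E \<in> Delta_RC f s msz IR" "cmat E \<in> Delta_plus f s msz"
proof -
  have off: "E $ j $ k = 0" if "\<not> block msz j \<le> f" "j \<noteq> k" for j k
    using assms(3)[of j k] split_block_scalar[of j k] that by blast
  have blocks: "block msz j = block msz k" if "split_block f msz j = split_block f msz k" for j k :: 'm
  proof (cases "block msz j \<le> f")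
    case True
    then have "block msz k \<le> f" using that split_block_le_iff by metis
    then show ?thesis using that True by (simp add: split_block_def)
  next
    case False
    then show ?thesis using split_block_scalar[OF that] by simp
  qed
  have RC: "cmat E = (\<chi> j k. if block msz j \<noteq> block msz k then 0
             else if block msz j \<le> f then cmat E $ j $ k
             else if j = k then of_real d else 0)"
  proof -
    have "E $ j $ k = 0" if "block msz j \<noteq> block msz k" for j k
      using that blocks assms(3) by metis
    then show ?thesis using off assms(4) by (auto simp: cmat_def vec_eq_iff)
  qed
  show "cmat E \<in> Delta_RC f s msz IR"
    unfolding Delta_RC_def
    by (intro CollectI exI[of _ "\<lambda>_. cmat E"] exI[of _ "\<lambda>_. complex_of_real d"] conjI, rule RC)
      (simp_all add: cmat_def)
  have plus: "cmat E = (\<chi> j k. if split_block f msz j \<noteq> split_block f msz k then 0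
             else if split_block f msz j \<le> f then of_real (E $ j $ k)
             else of_real d)"
  proof -
    have "E $ j $ k = d" if "split_block f msz j = split_block f msz k" "\<not> split_block f msz k \<le> f"
      for j k
      using that split_block_scalar[of j k] assms(4)[of j] split_block_le_iff by metis
    then show ?thesis using assms(3) by (auto simp: cmat_def vec_eq_iff)
  qed
  show "cmat E \<in> Delta_plus f s msz"
    unfolding Delta_plus_def
    by (intro CollectI exI[of _ "\<lambda>_. E"] exI[of _ "\<lambda>_. d"] conjI, rule plus)
      (simp_all add: assms(1,2))
qed

text \<open>Weights indexed by coordinates and constant on blocks are the form in which the
  dichotomy delivers them.\<close>

lemma Theta_eq:
  "(Theta f s msz :: (complex ^ 'm::_ ^ 'm::_) set) =
    {\<chi> j k. if j = k then of_real (\<theta> j) else 0 | \<theta>.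
      (\<forall>j. \<theta> j > 0) \<and> (\<forall>j k. split_block f msz j = split_block f msz k \<longrightarrow> \<theta> j = \<theta> k)}"
  (is "?L = ?R")
proof (intro subset_antisym subsetI)
  fix \<Theta> :: "complex ^ 'm::_ ^ 'm::_"
  assume "\<Theta> \<in> ?L"
  then obtain \<theta> :: "nat \<Rightarrow> real" where "\<Theta> = (\<chi> j k. if j = k then of_real (\<theta> (split_block f msz j)) else 0)"
    "\<forall>k\<in>{1..f+sbar f s msz}. \<theta> k > 0"
    unfolding Theta_def by blast
  then show "\<Theta> \<in> ?R"
    using split_block_bounds by (intro CollectI exI[of _ "\<lambda>j. \<theta> (split_block f msz j)"]) auto
next
  fix \<Theta> :: "complex ^ 'm::_ ^ 'm::_"
  assume "\<Theta> \<in> ?R"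
  then obtain \<theta> where \<Theta>: "\<Theta> = (\<chi> j k. if j = k then of_real (\<theta> j) else 0)"
    and pos: "\<And>j. \<theta> j > 0"
    and blk: "\<And>j k. split_block f msz j = split_block f msz k \<Longrightarrow> \<theta> j = \<theta> k"
    by blast
  \<comment> \<open>The weight of a representative coordinate; a number without coordinates receives
    the weight of an arbitrary one, which is still positive.\<close>
  define \<phi> where "\<phi> b = \<theta> (SOME j. split_block f msz j = b)" for b
  have "\<phi> (split_block f msz j) = \<theta> j" for j
    unfolding \<phi>_def by (rule blk) (rule someI, rule refl)
  then have "\<Theta> = (\<chi> j k. if j = k then of_real (\<phi> (split_block f msz j)) else 0)"
    by (simp add: \<Theta> vec_eq_iff)
  moreover have "\<phi> b > 0" for b by (simp add: \<phi>_def pos)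
  ultimately show "\<Theta> \<in> ?L" unfolding Theta_def by blast
qed

text \<open>Only two properties of the uncertainty set \<open>D\<close> enter: \<open>comm\<close>
  gives the upper bound and \<open>scalar\<close> the lower one. Both structures have them, and the
  right-hand side does not depend on \<open>D\<close>.\<close>

lemma Sup_mu_eq_Inf_Theta:
  fixes G :: "complex \<Rightarrow> complex ^ 'm::_ ^ 'm::_"
  assumes "positively_dominated G"
    and comm: "\<And>\<Delta> j k. \<Delta> \<in> D \<Longrightarrow> \<Delta> $ j $ k \<noteq> 0 \<Longrightarrow> split_block f msz j = split_block f msz k"
    and scalar: "\<And>E d. d \<ge> 0 \<Longrightarrow> (\<And>j k. E $ j $ k \<ge> 0) \<Longrightarrow>
      (\<And>j k. split_block f msz j \<noteq> split_block f msz k \<Longrightarrow> E $ j $ k = 0) \<Longrightarrow>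
      (\<And>j. \<not> block msz j \<le> f \<Longrightarrow> E $ j $ j = d) \<Longrightarrow> cmat E \<in> D"
  shows "(SUP \<omega>::real. ereal (mu (G (\<i> * of_real \<omega>)) D)) =
    (INF \<Theta>\<in>Theta f s msz. ereal (spectral_norm (diag_powr \<Theta> (1/2) ** G 0 ** diag_powr \<Theta> (- 1/2))))"
    (is "?sup = ?inf")
proof (rule antisym)
  define P :: "real ^ 'm::_ ^ 'm::_" where "P = (\<chi> i k. Re (G 0 $ i $ k))"
  have G0: "G 0 = cmat P"
    using assms(1) by (simp add: positively_dominated_def P_def cmat_def vec_eq_iff)
  have dom: "cmod (G (\<i> * of_real \<omega>) $ i $ k) \<le> P $ i $ k" for \<omega> i k
  proof -
    have "ereal (cmod (G (\<i> * of_real \<omega>) $ i $ k)) \<le> (SUP \<omega>::real. ereal (cmod (G (\<i> * of_real \<omega>) $ i $ k)))"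
      by (rule SUP_upper) simp
    then show ?thesis using assms(1) by (simp add: positively_dominated_def P_def)
  qed
  have P: "P $ i $ k \<ge> 0" for i k by (rule order_trans[OF norm_ge_zero dom[of 0]])
  show "?sup \<le> ?inf"
  proof (intro SUP_least INF_greatest)
    fix \<omega> :: real and \<Theta> :: "complex ^ 'm::_ ^ 'm::_"
    assume "\<Theta> \<in> Theta f s msz"
    then obtain \<theta> where \<Theta>: "\<Theta> = (\<chi> j k. if j = k then of_real (\<theta> j) else 0)"
      and pos: "\<And>j. \<theta> j > 0"
      and blk: "\<And>j k. split_block f msz j = split_block f msz k \<Longrightarrow> \<theta> j = \<theta> k"
      unfolding Theta_eq by blast
    have "mu (G (\<i> * of_real \<omega>)) D \<le> spectral_norm (diag_scale \<theta> (cmat P))"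
      using comm blk by (intro mu_le_diag_scale dom pos) blast
    then show "ereal (mu (G (\<i> * of_real \<omega>)) D)
        \<le> ereal (spectral_norm (diag_powr \<Theta> (1/2) ** G 0 ** diag_powr \<Theta> (- 1/2)))"
      unfolding \<Theta> diag_powr_conjugate G0 by simp
  qed
  \<comment> \<open>The lower bound is obtained at frequency \<open>0\<close>, where
    \<open>G\<close> equals the dominating matrix itself.\<close>
  have "?inf \<le> ereal (mu (G 0) D)"
  proof (rule ccontr)
    assume "\<not> ?thesis"
    then have "ereal (mu (G 0) D) < ?inf" by (simp only: not_le)
    \<comment> \<open>For \<open>c\<close> strictly in between, a scaling contradicts
      \<open>ereal c < ?inf\<close>, and a witness contradicts
      \<open>mu (G 0) D < c\<close>.\<close>
    from ereal_dense2[OF this] obtain c where "ereal (mu (G 0) D) < ereal c" and c2: "ereal c < ?inf"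
      by blast
    then have c: "mu (G 0) D < c" by simp
    have "c > 0" using c mu_nonneg[of "G 0" D] by simp
    show False
    proof (rule block_scaling_dichotomy[of P "split_block f msz" c])
      fix \<theta> assume pos: "\<And>k. 0 < \<theta> k"
        and blk: "\<And>j k. split_block f msz j = split_block f msz k \<Longrightarrow> \<theta> j = \<theta> k"
        and le: "\<And>x. (\<And>k. 0 \<le> x $ k) \<Longrightarrow>
          (\<Sum>k\<in>UNIV. \<theta> k * ((P *v x) $ k)\<^sup>2) \<le> c\<^sup>2 * (\<Sum>k\<in>UNIV. \<theta> k * (x $ k)\<^sup>2)"
      define \<Theta> :: "complex ^ 'm::_ ^ 'm::_" where "\<Theta> = (\<chi> j k. if j = k then of_real (\<theta> j) else 0)"
      have "\<Theta> \<in> Theta f s msz"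
        unfolding Theta_eq \<Theta>_def using pos blk by blast
      then have "?inf \<le> ereal (spectral_norm (diag_powr \<Theta> (1/2) ** G 0 ** diag_powr \<Theta> (- 1/2)))"
        by (rule INF_lower)
      also have "\<dots> = ereal (spectral_norm (diag_scale \<theta> (cmat P)))"
        unfolding \<Theta>_def diag_powr_conjugate G0 ..
      also have "\<dots> \<le> ereal c"
        using spectral_norm_diag_scale_le[OF P pos _ le] \<open>c > 0\<close> by simp
      finally show False using c2 by simp
    next
      fix x assume x: "\<And>k. 0 \<le> x $ k" "x \<noteq> 0"
        and wit: "\<And>j :: 'm. c\<^sup>2 * (\<Sum>k | split_block f msz k = split_block f msz j. (x $ k)\<^sup>2)
          \<le> (\<Sum>k | split_block f msz k = split_block f msz j. ((P *v x) $ k)\<^sup>2)"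
      have full: "(block msz j \<le> f) = (block msz k \<le> f)"
        if "split_block f msz j = split_block f msz k" for j k :: 'm
        using that split_block_le_iff by metis
      show False
      proof (rule singular_perturbation_exists[of P c x "split_block f msz" "\<lambda>j. block msz j \<le> f"])
        fix E :: "real ^ 'm::_ ^ 'm::_" and d :: real
        assume E: "0 \<le> d" "\<And>j k. 0 \<le> E $ j $ k"
          "\<And>j k. split_block f msz j \<noteq> split_block f msz k \<Longrightarrow> E $ j $ k = 0"
          "\<And>j. \<not> block msz j \<le> f \<Longrightarrow> E $ j $ j = d"
          and n: "spectral_norm (cmat E) \<le> 1 / c" and sing: "det (mat 1 - cmat P ** cmat E) = 0"
        have "cmat E \<in> D" using E by (rule scalar)
        then have "c \<le> mu (cmat P) D" using \<open>c > 0\<close> sing n by (intro mu_ge)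
        then show False using c by (simp add: G0)
      qed (fact P \<open>c > 0\<close> x wit full split_block_scalar)+
    qed (rule P)
  qed
  also have "\<dots> = ereal (mu (G (\<i> * of_real 0)) D)" by simp
  also have "\<dots> \<le> ?sup" by (rule SUP_upper) simp
  finally show "?inf \<le> ?sup" .
qed

end

theorem theorem10:
  fixes M :: "(real \<Rightarrow> complex ^ 'm::{finite,linorder}) \<Rightarrow> (real \<Rightarrow> complex ^ 'm::{finite,linorder})"
    and Mhat :: "complex \<Rightarrow> complex ^ 'm::{finite,linorder} ^ 'm::{finite,linorder}"
    and f s :: nat and msz :: "nat \<Rightarrow> nat" and IR IC :: "nat set"
  assumes "M \<in> H_inf"
    and "has_transfer_function M Mhat"
    and "positively_dominated Mhat"
    and "\<forall>i\<in>{1..f+s}. msz i \<ge> 1"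
    and "(\<Sum>i=1..f+s. msz i) = CARD('m)"
    and "IR \<union> IC = {1..f+s}" and "IR \<inter> IC = {}"
  shows "(SUP \<omega>::real. ereal (mu (Mhat (\<i> * of_real \<omega>)) (Delta_RC f s msz IR))) =
           (SUP \<omega>::real. ereal (mu (Mhat (\<i> * of_real \<omega>)) (Delta_plus f s msz))) \<and>
         (SUP \<omega>::real. ereal (mu (Mhat (\<i> * of_real \<omega>)) (Delta_plus f s msz))) =
           (INF \<Theta>\<in>Theta f s msz.
              ereal (spectral_norm (diag_powr \<Theta> (1/2) ** Mhat 0 ** diag_powr \<Theta> (- 1/2))))"
proof -
  note key = Sup_mu_eq_Inf_Theta[OF assms(5,3)]
  note mem = repeated_scalar_in_Delta[OF assms(5)]
  have "(SUP \<omega>::real. ereal (mu (Mhat (\<i> * of_real \<omega>)) (Delta_RC f s msz IR))) =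
      (INF \<Theta>\<in>Theta f s msz.
        ereal (spectral_norm (diag_powr \<Theta> (1/2) ** Mhat 0 ** diag_powr \<Theta> (- 1/2))))"
    by (rule key[OF Delta_RC_commute[OF assms(5)] mem(1)])
  moreover have "(SUP \<omega>::real. ereal (mu (Mhat (\<i> * of_real \<omega>)) (Delta_plus f s msz))) =
      (INF \<Theta>\<in>Theta f s msz.
        ereal (spectral_norm (diag_powr \<Theta> (1/2) ** Mhat 0 ** diag_powr \<Theta> (- 1/2))))"
    by (rule key[OF Delta_plus_commute[OF assms(5)] mem(2)])
  ultimately show ?thesis by simp
qed

end
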